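(* Let $r$ and $n$ be positive integers and let $\omega$ be a primitive $r$th root of $1$. Let $0\le b\le r-1$ be an integer and let $\mathbf S=(S_1,\dots,S_n)$ be an $n$-tuple of non-empty subsets of $\mathbb Z_r$. Then $$\sum_{\pi\in G_{r,n}(\mathbf S)} \chi_{0,b}(\pi)\,t^{\mathrm{fdes}(\pi)}q^{\mathrm{fmaj}(\pi)}\prod_{i=1}^{n}x_i^{z_i} = \sum_{\pi\in G_{r,n}(\mathbf S)}t^{\mathrm{fdes}(\pi)}(\omega^bq)^{\mathrm{fmaj}(\pi)}\prod_{i=1}^{n}x_i^{z_i}.$$ In particular, $$\sum_{\pi\in G_{r,n}} \chi_{0,b}(\pi)\,t^{\mathrm{fdes}(\pi)}q^{\mathrm{fmaj}(\pi)}x^{\mathrm{col}(\pi)} = \sum_{\pi\in G_{r,n}}t^{\mathrm{fdes}(\pi)}(\omega^bq)^{\mathrm{fmaj}(\pi)}x^{\mathrm{col}(\pi)}.$$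
   Context: Here $t,q,x,x_1,\dots,x_n$ are commuting indeterminates. For positive integers $r,n$, $G_{r,n}=\mathbb{Z}_r\wr\mathfrak{S}_n$ is the group of colored permutations: its elements are pairs $\pi=(\sigma,\mathbf z)$ with $\sigma=\sigma_1\cdots\sigma_n\in\mathfrak S_n$ and $\mathbf z=(z_1,\dots,z_n)$, where each color $z_i\in\mathbb Z_r$ is represented by an integer in $\{0,1,\dots,r-1\}$. One writes $\pi=\pi_1\pi_2\cdots\pi_n$ with $\pi_i=\sigma_i^{[z_i]}$ (superscript $[0]$ omitted). In sums over $\pi=(\sigma,\mathbf z)$, $z_i$ denotes the $i$-th color of $\pi$. Restricted colored permutations: $G_{r,n}(\mathbf S)=\{(\sigma,\mathbf z)\in G_{r,n}: z_i\in S_i\text{ for all }i\}$. Color sum: $\mathrm{col}(\pi)=\sum_{i=1}^n z_i$ (an integer). Length: $\ell(\pi)=\mathrm{inv}(\pi)+\sum_{i:\,z_i>0}(\sigma_i+z_i-1)$, where $\mathrm{inv}(\pi)=|\{(i,j): i<j,\ \pi_i>\pi_j\}|$ is computed with respect to the linear order $n^{[r-1]}<\cdots<n^{[1]}<\cdots<1^{[r-1]}<\cdots<1^{[1]}<1<\cdots<n$. One-dimensional characters: $\chi_{a,b}(\pi)=(-1)^{a(\ell(\pi)-\mathrm{col}(\pi))}\omega^{b\,\mathrm{col}(\pi)}$ for $a\in\{0,1\}$, $0\le b\le r-1$; in particular $\chi_{0,b}(\pi)=\omega^{b\,\mathrm{col}(\pi)}$. Flag statistics: $\mathrm{Des}_F(\pi)=\{i\in\{1,\dots,n-1\}:\pi_i>\pi_{i+1}\}$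 with respect to the (different) linear order $1^{[r-1]}<\cdots<n^{[r-1]}<\cdots<1^{[1]}<\cdots<n^{[1]}<1<\cdots<n$; $\mathrm{des}_F(\pi)=|\mathrm{Des}_F(\pi)|$, $\mathrm{maj}_F(\pi)=\sum_{i\in\mathrm{Des}_F(\pi)}i$, $\mathrm{fdes}(\pi)=r\cdot\mathrm{des}_F(\pi)+z_1$, and $\mathrm{fmaj}(\pi)=r\cdot\mathrm{maj}_F(\pi)+\mathrm{col}(\pi)$. *)

theory Defs
  imports Complex_Main "HOL-Library.FuncSet" "HOL-Library.Poly_Mapping"
    "HOL-Combinatorics.Permutations"
begin

text \<open>
  The polynomial ring in commuting indeterminates \<open>t, q, x, x\<^sub>1, x\<^sub>2, \<dots>\<close>
  over the complex numbers: finitely supported maps from monomials (exponent vectors) to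
  coefficients, with the convolution product.
\<close>

datatype indet = T | Q | X | Xi nat

type_synonym cpoly = "(indet \<Rightarrow>\<^sub>0 nat) \<Rightarrow>\<^sub>0 complex"

definition Var :: "indet \<Rightarrow> cpoly" where
  "Var v = Poly_Mapping.single (Poly_Mapping.single v 1) 1"

definition Const :: "complex \<Rightarrow> cpoly" where
  "Const c = Poly_Mapping.single 0 c"

definition primitive_root_of_one :: "nat \<Rightarrow> complex \<Rightarrow> bool" where
  "primitive_root_of_one r \<omega> \<longleftrightarrow> \<omega> ^ r = 1 \<and> (\<forall>k. 0 < k \<and> k < r \<longrightarrow> \<omega> ^ k \<noteq> 1)"

text \<open>
  A colored permutation is a pair \<open>(\<sigma>, z)\<close>, where \<open>\<sigma>\<close> permutes \<open>{1..n}\<close> and \<open>z i\<close> is the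
  representative in \<open>{0,\<dots>,r-1}\<close> of the \<open>i\<close>-th color. Outside \<open>{1..n}\<close>, \<open>\<sigma>\<close> is the identity and
  \<open>z\<close> is \<open>undefined\<close>, so that distinct pairs are distinct colored permutations.
\<close>

type_synonym colperm = "(nat \<Rightarrow> nat) \<times> (nat \<Rightarrow> nat)"

definition colored_perms :: "nat \<Rightarrow> nat \<Rightarrow> colperm set" where
  "colored_perms r n = {\<sigma>. \<sigma> permutes {1..n}} \<times> ({1..n} \<rightarrow>\<^sub>E {0..<r})"

definition restricted_colored_perms :: "nat \<Rightarrow> nat \<Rightarrow> (nat \<Rightarrow> nat set) \<Rightarrow> colperm set" where
  "restricted_colored_perms r n S = {\<pi> \<in> colored_perms r n. \<forall>i\<in>{1..n}. snd \<pi> i \<in> S i}"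

text \<open>The letter \<open>\<sigma>\<^sub>i\<close> with color \<open>z\<^sub>i\<close> is the pair \<open>(\<sigma> i, z i)\<close>.\<close>

definition letter :: "colperm \<Rightarrow> nat \<Rightarrow> nat \<times> nat" where
  "letter \<pi> i = (fst \<pi> i, snd \<pi> i)"

definition col :: "nat \<Rightarrow> colperm \<Rightarrow> nat" where
  "col n \<pi> = (\<Sum>i=1..n. snd \<pi> i)"

text \<open>
  The order used for the length:
  \<open>n\<^sup>[\<^sup>r\<^sup>-\<^sup>1\<^sup>] < \<dots> < n\<^sup>[\<^sup>1\<^sup>] < \<dots> < 1\<^sup>[\<^sup>r\<^sup>-\<^sup>1\<^sup>] < \<dots> < 1\<^sup>[\<^sup>1\<^sup>] < 1 < \<dots> < n\<close>.
\<close>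

fun less_len :: "nat \<times> nat \<Rightarrow> nat \<times> nat \<Rightarrow> bool" where
  "less_len (a, c) (b, d) \<longleftrightarrow>
     (if c = 0 then d = 0 \<and> a < b else d = 0 \<or> b < a \<or> (a = b \<and> d < c))"

text \<open>
  The order used for the flag statistics:
  \<open>1\<^sup>[\<^sup>r\<^sup>-\<^sup>1\<^sup>] < \<dots> < n\<^sup>[\<^sup>r\<^sup>-\<^sup>1\<^sup>] < \<dots> < 1\<^sup>[\<^sup>1\<^sup>] < \<dots> < n\<^sup>[\<^sup>1\<^sup>] < 1 < \<dots> < n\<close>.
\<close>

fun less_flag :: "nat \<times> nat \<Rightarrow> nat \<times> nat \<Rightarrow> bool" where
  "less_flag (a, c) (b, d) \<longleftrightarrow> d < c \<or> (c = d \<and> a < b)"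

definition inv_len :: "nat \<Rightarrow> colperm \<Rightarrow> nat" where
  "inv_len n \<pi> =
     card {(i, j). i \<in> {1..n} \<and> j \<in> {1..n} \<and> i < j \<and> less_len (letter \<pi> j) (letter \<pi> i)}"

text \<open>The truncated subtraction is exact, since every \<open>\<sigma> i\<close> is positive.\<close>

definition len :: "nat \<Rightarrow> colperm \<Rightarrow> nat" where
  "len n \<pi> = inv_len n \<pi> + (\<Sum>i\<in>{i\<in>{1..n}. snd \<pi> i > 0}. fst \<pi> i + snd \<pi> i - 1)"

definition chi :: "complex \<Rightarrow> nat \<Rightarrow> nat \<Rightarrow> nat \<Rightarrow> colperm \<Rightarrow> complex" where
  "chi \<omega> n a b \<pi> =
     (-1) powi (int a * (int (len n \<pi>) - int (col n \<pi>))) * \<omega> ^ (b * col n \<pi>)"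

definition Des_F :: "nat \<Rightarrow> colperm \<Rightarrow> nat set" where
  "Des_F n \<pi> = {i \<in> {1..<n}. less_flag (letter \<pi> (i + 1)) (letter \<pi> i)}"

definition des_F :: "nat \<Rightarrow> colperm \<Rightarrow> nat" where
  "des_F n \<pi> = card (Des_F n \<pi>)"

definition maj_F :: "nat \<Rightarrow> colperm \<Rightarrow> nat" where
  "maj_F n \<pi> = (\<Sum>i\<in>Des_F n \<pi>. i)"

definition fdes :: "nat \<Rightarrow> nat \<Rightarrow> colperm \<Rightarrow> nat" where
  "fdes r n \<pi> = r * des_F n \<pi> + snd \<pi> 1"

definition fmaj :: "nat \<Rightarrow> nat \<Rightarrow> colperm \<Rightarrow> nat" where
  "fmaj r n \<pi> = r * maj_F n \<pi> + col n \<pi>"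

end

theory Submission
  imports Defs
begin

text \<open>
  The identity holds term by term. Since \<open>fmaj = r * maj_F + col\<close> and \<open>\<omega>\<close> is an
  \<open>r\<close>-th root of unity, \<open>(\<omega>\<^sup>b)\<close> raised to the power \<open>fmaj\<close> depends on the color sum alone
  and equals the character value \<open>\<omega>\<close> to the power \<open>b * col\<close>. Attaching the scalar
  \<open>\<omega>\<^sup>b\<close> to each factor \<open>q\<close> of \<open>q\<close> to the power \<open>fmaj\<close> therefore multiplies the
  monomial by exactly that character value.
\<close>

lemma Const_mult: "Const c * Const d = Const (c * d)"
  by (simp add: Const_def mult_single)

lemma Const_power: "Const c ^ k = Const (c ^ k)"
proof (induction k)
  case 0
  show ?case by (simp add: Const_def)
next
  case (Suc k)
  then show ?case by (simp add: Const_mult)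
qed

text \<open>
  The summand \<open>r * maj_F\<close> of \<open>fmaj\<close> contributes only a power of \<open>\<omega>\<^sup>r = 1\<close>, which leaves
  the part coming from the color sum.
\<close>
lemma chi_0_eq_power_fmaj:
  assumes "\<omega> ^ r = 1"
  shows "chi \<omega> n 0 b \<pi> = (\<omega> ^ b) ^ fmaj r n \<pi>"
proof -
  have "(\<omega> ^ b) ^ fmaj r n \<pi> = (\<omega> ^ r) ^ (b * maj_F n \<pi>) * \<omega> ^ (b * col n \<pi>)"
    by (simp add: fmaj_def flip: power_mult power_add) (simp add: algebra_simps)
  with assms show ?thesis
    by (simp add: chi_def)
qed

text \<open>
  The cofactors \<open>A\<close> and \<open>B\<close> are arbitrary so that the refined sum, weighted by the product of
  the \<open>x\<^sub>i\<close>, and the specialised sum, weighted by a power of \<open>x\<close>, are both instances.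
\<close>
lemma Const_chi_0_mult_monomial:
  assumes "\<omega> ^ r = 1"
  shows "Const (chi \<omega> n 0 b \<pi>) * A * Var Q ^ fmaj r n \<pi> * B
       = A * (Const (\<omega> ^ b) * Var Q) ^ fmaj r n \<pi> * B"
  using chi_0_eq_power_fmaj[OF assms, of n b \<pi>]
  by (simp add: power_mult_distrib Const_power mult_ac)

theorem theorem2p4:
  fixes r n b :: nat and \<omega> :: complex and S :: "nat \<Rightarrow> nat set"
  assumes "r \<ge> 1" and "n \<ge> 1"
    and "primitive_root_of_one r \<omega>"
    and "b \<le> r - 1"
    and "\<forall>i\<in>{1..n}. S i \<subseteq> {0..<r} \<and> S i \<noteq> {}"
  shows "(\<Sum>\<pi>\<in>restricted_colored_perms r n S.
            Const (chi \<omega> n 0 b \<pi>) * Var T ^ fdes r n \<pi> * Var Q ^ fmaj r n \<pi>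
              * (\<Prod>i=1..n. Var (Xi i) ^ snd \<pi> i))
       = (\<Sum>\<pi>\<in>restricted_colored_perms r n S.
            Var T ^ fdes r n \<pi> * (Const (\<omega> ^ b) * Var Q) ^ fmaj r n \<pi>
              * (\<Prod>i=1..n. Var (Xi i) ^ snd \<pi> i))
     \<and> (\<Sum>\<pi>\<in>colored_perms r n.
            Const (chi \<omega> n 0 b \<pi>) * Var T ^ fdes r n \<pi> * Var Q ^ fmaj r n \<pi> * Var X ^ col n \<pi>)
       = (\<Sum>\<pi>\<in>colored_perms r n.
            Var T ^ fdes r n \<pi> * (Const (\<omega> ^ b) * Var Q) ^ fmaj r n \<pi> * Var X ^ col n \<pi>)"
proof -
  have "\<omega> ^ r = 1"
    using assms(3) by (simp add: primitive_root_of_one_def)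
  then show ?thesis
    by (simp only: Const_chi_0_mult_monomial)
qed

end
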